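(* Let $T$ be a Toeplitz matrix. If the row graph $\mathrm{RG}(T)$ is triangle-free, then the maximum row sum of $T$ is at most $2$.
   Context: Write $[m]=\{1,\dots,m\}$. For disjoint subsets $\alpha,\beta\subseteq[n-1]$, not both empty, $T_n\langle\alpha;\beta\rangle$ denotes the $n\times n$ $(0,1)$-matrix $(t_{u,v})$ with $t_{u,v}=1$ if and only if $u-v\in\alpha$ or $v-u\in\beta$. Here "Toeplitz matrix" means a matrix of this form (equivalently, a nonzero $(0,1)$-Toeplitz matrix with zero diagonal such that $t_{u,v}=1$ implies $t_{v,u}=0$). Row sums are computed in the integers. The row graph $\mathrm{RG}(T)$ of an $n\times n$ $(0,1)$-matrix $T=(t_{u,v})$ is the simple graph with vertex set $[n]$ in which two distinct vertices $u,v$ are adjacent if and only if $t_{u,k}=t_{v,k}=1$ for some $k\in[n]$. *)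

theory Defs
  imports "Jordan_Normal_Form.Matrix" "Graph_Theory.Pair_Digraph"
begin

(* Library matrices are indexed from 0, so the row and column labels 1, ..., n of the
   mathematical text become 0, ..., n - 1.  The entries depend only on differences of
   indices and are unaffected.  The differences are taken in int, where subtraction
   does not truncate; accordingly alpha and beta are sets of integers. *)
definition toeplitz_mat :: "nat \<Rightarrow> int set \<Rightarrow> int set \<Rightarrow> int mat" where
  "toeplitz_mat n \<alpha> \<beta> =
    mat n n (\<lambda>(u, v). if int u - int v \<in> \<alpha> \<or> int v - int u \<in> \<beta> then 1 else 0)"

definition is_toeplitz :: "nat \<Rightarrow> int mat \<Rightarrow> bool" where
  "is_toeplitz n T \<longleftrightarrow>
    (\<exists>\<alpha> \<beta>. \<alpha> \<subseteq> {1..int n - 1} \<and> \<beta> \<subseteq> {1..int n - 1} \<and> \<alpha> \<inter> \<beta> = {} \<and>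
      \<not> (\<alpha> = {} \<and> \<beta> = {}) \<and> T = toeplitz_mat n \<alpha> \<beta>)"

(* A finite simple graph is a pair_graph: a finite, loop-free, symmetric digraph without
   parallel arcs, each edge being represented by its two opposite arcs. *)
definition row_graph :: "int mat \<Rightarrow> nat pair_pre_digraph" where
  "row_graph T =
    \<lparr> pverts = {..<dim_row T},
      parcs = {(u, v). u < dim_row T \<and> v < dim_row T \<and> u \<noteq> v \<and>
                 (\<exists>k<dim_col T. T $$ (u, k) = 1 \<and> T $$ (v, k) = 1)} \<rparr>"

lemma pair_graph_row_graph: "pair_graph (row_graph T)"
proof
  show "finite (parcs (row_graph T))"
    by (rule finite_subset[of _ "{..<dim_row T} \<times> {..<dim_row T}"]) (auto simp: row_graph_def)
  show "symmetric (with_proj (row_graph T))"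
    by (auto simp: row_graph_def symmetric_def intro!: symI)
qed (auto simp: row_graph_def)

definition triangle_free :: "'a pair_pre_digraph \<Rightarrow> bool" where
  "triangle_free G \<longleftrightarrow>
    \<not> (\<exists>u \<in> pverts G. \<exists>v \<in> pverts G. \<exists>w \<in> pverts G. u \<noteq> v \<and> v \<noteq> w \<and> u \<noteq> w \<and>
        (u, v) \<in> parcs G \<and> (v, w) \<in> parcs G \<and> (u, w) \<in> parcs G)"

definition row_sum :: "int mat \<Rightarrow> nat \<Rightarrow> int" where
  "row_sum T u = (\<Sum>k<dim_col T. T $$ (u, k))"

(* Meaningful only for matrices with at least one row, since Max {} is unspecified.
   By nonemptiness of alpha or beta, is_toeplitz n T forces n >= 2. *)
definition max_row_sum :: "int mat \<Rightarrow> int" where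
  "max_row_sum T = Max (row_sum T ` {..<dim_row T})"

end

theory Submission
  imports Defs
begin

text \<open>
  The entry of a Toeplitz matrix at \<open>(u, v)\<close> depends only on \<open>u - v\<close>, so reflection in the
  anti-diagonal, which sends \<open>(u, v)\<close> to \<open>(n - 1 - v, n - 1 - u)\<close>, preserves the matrix.
  This reflection turns the ones of row \<open>u\<close> into the ones of column \<open>n - 1 - u\<close>. Rows having
  a one in a common column are pairwise adjacent in the row graph, so triangle-freeness allows
  at most two ones in each column (lemma \<open>triangle_free_column_ones\<close>), and by the reflection
  (lemma \<open>toeplitz_mat_reflect\<close>) at most two in each row.
\<close>

lemma toeplitz_mat_reflect:
  assumes "u < n" "v < n"
  shows "toeplitz_mat n \<alpha> \<beta> $$ (n - 1 - v, n - 1 - u) = toeplitz_mat n \<alpha> \<beta> $$ (u, v)"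
proof -
  have "int (n - 1 - v) - int (n - 1 - u) = int u - int v"
    and "int (n - 1 - u) - int (n - 1 - v) = int v - int u"
    using assms by auto
  then show ?thesis
    using assms by (simp add: toeplitz_mat_def)
qed

lemma row_sum_toeplitz_mat:
  assumes "u < n"
  shows "row_sum (toeplitz_mat n \<alpha> \<beta>) u = int (card {k. k < n \<and> toeplitz_mat n \<alpha> \<beta> $$ (u, k) = 1})"
proof -
  have "row_sum (toeplitz_mat n \<alpha> \<beta>) u
      = (\<Sum>k<n. if toeplitz_mat n \<alpha> \<beta> $$ (u, k) = 1 then 1 else 0)"
    unfolding row_sum_def using assms by (intro sum.cong) (auto simp: toeplitz_mat_def)
  also have "\<dots> = int (card {k \<in> {..<n}. toeplitz_mat n \<alpha> \<beta> $$ (u, k) = 1})"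
    by (simp flip: sum.inter_filter)
  finally show ?thesis
    by simp
qed

text \<open>The rows with a one in column \<open>v\<close> form a clique of the row graph.\<close>

lemma triangle_free_column_ones:
  assumes "triangle_free (row_graph T)" and "v < dim_col T"
  shows "card {r. r < dim_row T \<and> T $$ (r, v) = 1} \<le> 2"
proof (rule ccontr)
  assume "\<not> ?thesis"
  then have "3 \<le> card {r. r < dim_row T \<and> T $$ (r, v) = 1}"
    by simp
  then obtain R where "R \<subseteq> {r. r < dim_row T \<and> T $$ (r, v) = 1}" and "card R = 3"
    by (rule obtain_subset_with_card_n)
  then obtain a b c where "a \<noteq> b" "b \<noteq> c" "a \<noteq> c"
    and "{a, b, c} \<subseteq> {r. r < dim_row T \<and> T $$ (r, v) = 1}"
    by (auto simp: card_3_iff)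
  with assms show False
    by (auto simp: triangle_free_def row_graph_def)
qed

theorem corollary2p4:
  fixes n :: nat and T :: "int mat"
  assumes "is_toeplitz n T"
    and "triangle_free (row_graph T)"
  shows "max_row_sum T \<le> 2"
proof -
  from assms(1) obtain \<alpha> \<beta> where T: "T = toeplitz_mat n \<alpha> \<beta>"
    and "\<alpha> \<subseteq> {1..int n - 1}" "\<beta> \<subseteq> {1..int n - 1}" "\<not> (\<alpha> = {} \<and> \<beta> = {})"
    unfolding is_toeplitz_def by blast
  then have "n > 0"
    by (cases n) auto
  have dims: "dim_row T = n" "dim_col T = n"
    by (simp_all add: T toeplitz_mat_def)
  have "row_sum T u \<le> 2" if "u < n" for u
  proof -
    let ?row = "{k. k < n \<and> T $$ (u, k) = 1}"
    let ?col = "{r. r < n \<and> T $$ (r, n - 1 - u) = 1}"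
    have "inj_on (\<lambda>k. n - 1 - k) ?row"
      by (auto simp: inj_on_def)
    moreover have "(\<lambda>k. n - 1 - k) ` ?row \<subseteq> ?col"
      using that toeplitz_mat_reflect[of u n _ \<alpha> \<beta>] by (auto simp: T)
    ultimately have "card ?row \<le> card ?col"
      by (intro card_inj_on_le) auto
    also have "\<dots> \<le> 2"
      using triangle_free_column_ones[OF assms(2), of "n - 1 - u"] that by (simp add: dims)
    finally show ?thesis
      using row_sum_toeplitz_mat[OF that, of \<alpha> \<beta>] by (simp add: T)
  qed
  with \<open>n > 0\<close> show ?thesis
    unfolding max_row_sum_def by (subst Max_le_iff) (auto simp: dims)
qed

end
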